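(* Let $R$ be an associative unital ring and let $E$ be a row-finite directed graph which has no source. Equip the Leavitt path algebra $L_R(E)$ with its canonical $\mathbb{Z}$-gradation. Then $L_R(E)$ is strongly $\mathbb{Z}$-graded if and only if $E$ has no sink.
   Context: Graphs. A directed graph $E=(E^0,E^1,r,s)$ consists of sets $E^0$ (vertices), $E^1$ (edges) and maps $r,s:E^1\to E^0$ (range, source). A vertex $v$ is a sink if $s^{-1}(v)$ is empty, and a source if $r^{-1}(v)$ is empty. $E$ is row-finite if $s^{-1}(v)$ is a finite set for every $v\in E^0$. Leavitt path algebra. $L_R(E)$ is the (not necessarily unital) algebra with coefficients in $R$ generated by the sets $\{v\mid v\in E^0\}$, $\{f\mid f\in E^1\}$, $\{f^*\mid f\in E^1\}$, subject to: (1) $uv=\delta_{u,v}v$ for all $u,v\in E^0$; (2) $s(f)f=fr(f)=f$ and $r(f)f^*=f^*s(f)=f^*$ for all $f\in E^1$; (3) $f^*f'=\delta_{f,f'}r(f)$ for all $f,f'\in E^1$; (4) $\sum_{f\in E^1,\,s(f)=v}ff^*=v$ for every $v\in E^0$ for which $s^{-1}(v)$ is non-empty and finite. The elements of $R$ commute with the generators. Canonical $\mathbb{Z}$-gradation. It is the $\mathbb{Z}$-gradation on $L_R(E)$ determined by $\deg(v)=0$ for $v\in E^0$, $\deg(f)=1$ and $\deg(f^* )=-1$ for $f\in E^1$ (elements of $R$ have degree $0$). A $\mathbb{Z}$-graded ring $S=\bigoplus_{n\in\mathbb{Z}}S_n$ (so $S_mS_n\subseteq S_{m+n}$) is strongly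 $\mathbb{Z}$-graded if $S_mS_n=S_{m+n}$ for all $m,n\in\mathbb{Z}$, where products of additive subgroups denote the set of finite sums of products. *)

theory Defs
  imports
    "HOL-Library.Poly_Mapping"
    "HOL-Algebra.QuotRing"
    "Graph_Theory.Digraph"
begin

section \<open>Directed graphs\<close>

text \<open>
  A directed graph is a \<^locale>\<open>wf_digraph\<close>, possibly infinite and with loops and multiple edges.
  The source map \<open>s\<close> is \<^const>\<open>tail\<close>, the range map \<open>r\<close> is \<^const>\<open>head\<close>; hence the fibres
  \<open>s\<^sup>-\<^sup>1(v)\<close> and \<open>r\<^sup>-\<^sup>1(v)\<close> are \<^const>\<open>out_arcs\<close> and \<^const>\<open>in_arcs\<close>.
\<close>

definition is_sink :: "('v, 'e) pre_digraph \<Rightarrow> 'v \<Rightarrow> bool" where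
  "is_sink E v \<longleftrightarrow> v \<in> verts E \<and> out_arcs E v = {}"

definition is_source :: "('v, 'e) pre_digraph \<Rightarrow> 'v \<Rightarrow> bool" where
  "is_source E v \<longleftrightarrow> v \<in> verts E \<and> in_arcs E v = {}"

definition row_finite :: "('v, 'e) pre_digraph \<Rightarrow> bool" where
  "row_finite E \<longleftrightarrow> (\<forall>v \<in> verts E. finite (out_arcs E v))"


section \<open>Graded rings\<close>

text \<open>
  Rings without a multiplicative identity are represented by the records of \<open>HOL-Algebra\<close>, with
  the field \<^const>\<open>one\<close> left unconstrained; it need not even lie in the carrier.
\<close>

locale nonunital_ring = abelian_group S for S (structure) +
  assumes mult_closed: "\<lbrakk>x \<in> carrier S; y \<in> carrier S\<rbrakk> \<Longrightarrow> x \<otimes> y \<in> carrier S"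
    and mult_assoc: "\<lbrakk>x \<in> carrier S; y \<in> carrier S; z \<in> carrier S\<rbrakk>
      \<Longrightarrow> (x \<otimes> y) \<otimes> z = x \<otimes> (y \<otimes> z)"
    and distrib_right: "\<lbrakk>x \<in> carrier S; y \<in> carrier S; z \<in> carrier S\<rbrakk>
      \<Longrightarrow> (x \<oplus> y) \<otimes> z = x \<otimes> z \<oplus> y \<otimes> z"
    and distrib_left: "\<lbrakk>x \<in> carrier S; y \<in> carrier S; z \<in> carrier S\<rbrakk>
      \<Longrightarrow> z \<otimes> (x \<oplus> y) = z \<otimes> x \<oplus> z \<otimes> y"

definition sums_of_products :: "('a, 'm) ring_scheme \<Rightarrow> 'a set \<Rightarrow> 'a set \<Rightarrow> 'a set" where
  "sums_of_products S A B =
    {\<Oplus>\<^bsub>S\<^esub>i\<in>{..<k}. a i \<otimes>\<^bsub>S\<^esub> b i | (k :: nat) a b. (\<forall>i<k. a i \<in> A \<and> b i \<in> B)}"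

locale Z_graded_ring = nonunital_ring S for S (structure) and G :: "int \<Rightarrow> 'a set" +
  assumes component_subgroup: "additive_subgroup (G n) S"
    and direct_sum: "x \<in> carrier S \<Longrightarrow>
      \<exists>!c. (\<forall>n. c n \<in> G n) \<and> finite {n. c n \<noteq> \<zero>} \<and> x = (\<Oplus>n\<in>{n. c n \<noteq> \<zero>}. c n)"
    and component_mult: "sums_of_products S (G m) (G n) \<subseteq> G (m + n)"

locale strongly_Z_graded_ring = Z_graded_ring +
  assumes component_mult_eq: "sums_of_products S (G m) (G n) = G (m + n)"


section \<open>Leavitt path algebras\<close>

datatype 'g free_word = Word (letters: "'g list")

instantiation free_word :: (type) monoid_add
begin

definition zero_free_word :: "'a free_word" where
  "0 = Word []"

definition plus_free_word :: "'a free_word \<Rightarrow> 'a free_word \<Rightarrow> 'a free_word" where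
  "v + w = Word (letters v @ letters w)"

instance
  by standard (simp_all add: zero_free_word_def plus_free_word_def)

end

text \<open>
  With concatenation as addition of words, \<open>'g free_word \<Rightarrow>\<^sub>0 'r\<close> with its convolution
  product is the monoid ring of the free monoid on \<open>'g\<close>: the free unital \<open>'r\<close>-ring in which
  the coefficients commute with the generators (but not necessarily with each other).
  The coefficient rings in class \<^class>\<open>ring_1\<close> are the unital rings with \<open>0 \<noteq> 1\<close>.
\<close>

abbreviation word :: "'g list \<Rightarrow> 'g free_word \<Rightarrow>\<^sub>0 'r::ring_1" where
  "word gs \<equiv> Poly_Mapping.single (Word gs) 1"

definition free_ring :: "'g set \<Rightarrow> ('g free_word \<Rightarrow>\<^sub>0 'r::ring_1) ring" where
  "free_ring X =
    \<lparr>carrier = {p. \<forall>w \<in> Poly_Mapping.keys p. set (letters w) \<subseteq> X},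
     mult = (*), one = 1, zero = 0, add = (+)\<rparr>"

datatype ('v, 'e) lpa_gen = Vertex 'v | Edge 'e | Ghost 'e

definition lpa_gens :: "('v, 'e) pre_digraph \<Rightarrow> ('v, 'e) lpa_gen set" where
  "lpa_gens E = Vertex ` verts E \<union> Edge ` arcs E \<union> Ghost ` arcs E"

type_synonym ('v, 'e, 'r) lpa_free = "('v, 'e) lpa_gen free_word \<Rightarrow>\<^sub>0 'r"

definition lpa_relations :: "('v, 'e) pre_digraph \<Rightarrow> ('v, 'e, 'r::ring_1) lpa_free set" where
  "lpa_relations E =
    {word [Vertex u, Vertex v] - (if u = v then word [Vertex v] else 0) | u v.
       u \<in> verts E \<and> v \<in> verts E}
  \<union> {word [Vertex (tail E f), Edge f] - word [Edge f] | f. f \<in> arcs E}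
  \<union> {word [Edge f, Vertex (head E f)] - word [Edge f] | f. f \<in> arcs E}
  \<union> {word [Vertex (head E f), Ghost f] - word [Ghost f] | f. f \<in> arcs E}
  \<union> {word [Ghost f, Vertex (tail E f)] - word [Ghost f] | f. f \<in> arcs E}
  \<union> {word [Ghost f, Edge g] - (if f = g then word [Vertex (head E f)] else 0) | f g.
       f \<in> arcs E \<and> g \<in> arcs E}
  \<union> {(\<Sum>f\<in>out_arcs E v. word [Edge f, Ghost f]) - word [Vertex v] | v.
       v \<in> verts E \<and> out_arcs E v \<noteq> {} \<and> finite (out_arcs E v)}"

definition lpa_ideal :: "('v, 'e) pre_digraph \<Rightarrow> ('v, 'e, 'r::ring_1) lpa_free set" where
  "lpa_ideal E = genideal (free_ring (lpa_gens E)) (lpa_relations E)"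

definition lpa_class ::
    "('v, 'e) pre_digraph \<Rightarrow> ('v, 'e, 'r::ring_1) lpa_free \<Rightarrow> ('v, 'e, 'r) lpa_free set" where
  "lpa_class E p = a_r_coset (free_ring (lpa_gens E)) (lpa_ideal E) p"

text \<open>
  The Leavitt path algebra is not unital in general, so its carrier consists of the classes of
  those elements of the free unital ring that have zero constant term, i.e. of the elements of the
  free non-unital algebra. All relations have zero constant term, so the ideal generated by them
  lies in this non-unital algebra and is the ideal that they generate there, as an ideal closed
  under multiplication by coefficients. The field \<^const>\<open>one\<close> is a leftover of the quotient
  construction and has no meaning.
\<close>

definition leavitt_path_algebra ::
    "('v, 'e) pre_digraph \<Rightarrow> ('v, 'e, 'r::ring_1) lpa_free set ring" where
  "leavitt_path_algebra E =
    (free_ring (lpa_gens E) Quot lpa_ideal E)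
      \<lparr>carrier := lpa_class E `
        {p \<in> carrier (free_ring (lpa_gens E)). Poly_Mapping.lookup p 0 = 0}\<rparr>"

primrec gen_degree :: "('v, 'e) lpa_gen \<Rightarrow> int" where
  "gen_degree (Vertex v) = 0"
| "gen_degree (Edge f) = 1"
| "gen_degree (Ghost f) = -1"

definition word_degree :: "('v, 'e) lpa_gen free_word \<Rightarrow> int" where
  "word_degree w = (\<Sum>g\<leftarrow>letters w. gen_degree g)"

definition lpa_component ::
    "('v, 'e) pre_digraph \<Rightarrow> int \<Rightarrow> ('v, 'e, 'r::ring_1) lpa_free set set" where
  "lpa_component E n = lpa_class E `
    {p \<in> carrier (free_ring (lpa_gens E)). Poly_Mapping.lookup p 0 = 0 \<and>
       (\<forall>w \<in> Poly_Mapping.keys p. word_degree w = n)}"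

end

theory Submission
  imports Defs "Graph_Theory.Arc_Walk"
begin

text \<open>
  Let \<open>S\<close> be the Leavitt path algebra of \<open>E\<close>, and suppose first that \<open>E\<close> has no sink. A vertex \<open>v\<close> is then the range of some edge \<open>f\<close>, so that
  \<open>v = f\<^sup>* f\<close> with factors of degrees \<open>-1\<close> and \<open>1\<close>; and it emits a finite nonzero number of edges, so
  that \<open>v = \<Sum> f f\<^sup>*\<close> with factors of degrees \<open>1\<close> and \<open>-1\<close>. Inserting the middle vertex,
  \<open>f\<^sup>* f = f\<^sup>* s(f) f\<close> and \<open>f f\<^sup>* = f r(f) f\<^sup>*\<close>, and iterating gives \<open>v \<in> S\<^sub>m S\<^sub>-\<^sub>m\<close> for every integer \<open>m\<close>
  (\<open>vertex_factorizable\<close>). Every monomial \<open>w\<close> of degree \<open>m + n\<close> is fixed by a vertex on its left,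
  so \<open>w = v w \<in> S\<^sub>m S\<^sub>-\<^sub>m S\<^sub>m\<^sub>+\<^sub>n \<subseteq> S\<^sub>m S\<^sub>n\<close> (\<open>homogeneous_factorizable\<close>).

  Conversely, let \<open>v\<close> be a sink. The generators act by partial maps on the set of finite paths that end
  in \<open>v\<close>: a vertex keeps the paths starting there, an edge is prepended and a ghost edge removes the
  first edge. That \<open>v\<close> emits no edge is what makes the relation \<open>\<Sum> f f\<^sup>* = u\<close> hold on the empty path.
  A monomial of degree \<open>d\<close> changes the length of a path by \<open>d\<close> (\<open>length_path_act\<close>), so the coefficient
  of the empty path in the image of any path under an element of \<open>S\<^sub>1\<close> is zero. If \<open>v\<close> were in
  \<open>S\<^sub>1 S\<^sub>-\<^sub>1\<close>, the same would hold for \<open>v\<close>, which however fixes the empty path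
  (\<open>no_sink_if_strongly_graded\<close>).

  That the algebra is graded at all rests on the ideal of relations being homogeneous
  (\<open>hom_part_in_ideal\<close>). Throughout, classes are replaced by their representatives in the free ring,
  and equality of classes by membership of differences in the ideal (\<open>lpa_class_eq_iff\<close>).
\<close>

section \<open>The free ring\<close>

text \<open>
  This reduces a property that is compatible with addition to single terms.
  Only the support of \<open>p\<close> enters, so membership of \<open>p\<close> in a free ring passes to the terms.
\<close>

lemma poly_mapping_additive_induct [consumes 0, case_names zero add single]:
  fixes p :: "'k \<Rightarrow>\<^sub>0 'r::comm_monoid_add"
  assumes "P 0" and "\<And>q r. P q \<Longrightarrow> P r \<Longrightarrow> P (q + r)"
    and "\<And>w c. w \<in> Poly_Mapping.keys p \<Longrightarrow> P (Poly_Mapping.single w c)"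
  shows "P p"
proof -
  have "P (\<Sum>w\<in>A. Poly_Mapping.single w (Poly_Mapping.lookup p w))"
    if "finite A" "A \<subseteq> Poly_Mapping.keys p" for A
    using that by (induction A rule: finite_induct) (auto intro: assms)
  then have "P (\<Sum>w\<in>Poly_Mapping.keys p. Poly_Mapping.single w (Poly_Mapping.lookup p w))"
    by simp
  also have "(\<Sum>w\<in>Poly_Mapping.keys p. Poly_Mapping.single w (Poly_Mapping.lookup p w)) = p"
    by (rule poly_mapping_eqI)
      (auto simp: lookup_sum lookup_single when_def in_keys_iff)
  finally show ?thesis .
qed

lemma letters_plus [simp]: "letters (u + w) = letters u @ letters w"
  by (simp add: plus_free_word_def)

lemma letters_zero [simp]: "letters 0 = []"
  by (simp add: zero_free_word_def)

lemma plus_eq_0_free_word [simp]: "u + w = 0 \<longleftrightarrow> u = 0 \<and> w = (0 :: 'g free_word)"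
  by (cases u; cases w) (simp add: plus_free_word_def zero_free_word_def)

lemma word_mult: "word us * word ws = word (us @ ws)"
  by (simp add: mult_single plus_free_word_def)

lemma free_ring_simps [simp]:
  "x \<otimes>\<^bsub>free_ring X\<^esub> y = x * y" "x \<oplus>\<^bsub>free_ring X\<^esub> y = x + y"
  "\<zero>\<^bsub>free_ring X\<^esub> = 0" "\<one>\<^bsub>free_ring X\<^esub> = 1"
  by (simp_all add: free_ring_def)

lemma mem_free_ring:
  "p \<in> carrier (free_ring X) \<longleftrightarrow> (\<forall>w\<in>Poly_Mapping.keys p. set (letters w) \<subseteq> X)"
  by (simp add: free_ring_def)

lemma free_ring_closed [simp, intro]:
  "0 \<in> carrier (free_ring X)"
  "1 \<in> carrier (free_ring X)"
  "p \<in> carrier (free_ring X) \<Longrightarrow> q \<in> carrier (free_ring X) \<Longrightarrow> p + q \<in> carrier (free_ring X)"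
  "p \<in> carrier (free_ring X) \<Longrightarrow> q \<in> carrier (free_ring X) \<Longrightarrow> p - q \<in> carrier (free_ring X)"
  "p \<in> carrier (free_ring X) \<Longrightarrow> - p \<in> carrier (free_ring X)"
  "p \<in> carrier (free_ring X) \<Longrightarrow> q \<in> carrier (free_ring X) \<Longrightarrow> p * q \<in> carrier (free_ring X)"
  using keys_add[of p q] keys_diff[of p q] keys_mult[of p q]
  by (fastforce simp: mem_free_ring)+

lemma free_ring_sum_closed:
  "(\<And>i. i \<in> A \<Longrightarrow> p i \<in> carrier (free_ring X)) \<Longrightarrow> sum p A \<in> carrier (free_ring X)"
  by (induction A rule: infinite_finite_induct) auto

lemma single_mem_free_ring:
  "set (letters w) \<subseteq> X \<Longrightarrow> Poly_Mapping.single w c \<in> carrier (free_ring X)"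
  by (simp add: mem_free_ring)

lemma ring_free_ring: "ring (free_ring X)"
proof (intro ringI abelian_groupI monoidI)
  fix x :: "'a free_word \<Rightarrow>\<^sub>0 'b" assume "x \<in> carrier (free_ring X)"
  then show "\<exists>y\<in>carrier (free_ring X). y \<oplus>\<^bsub>free_ring X\<^esub> x = \<zero>\<^bsub>free_ring X\<^esub>"
    by (intro bexI[of _ "- x"]) auto
qed (auto simp: algebra_simps)

text \<open>
  Closure under negation comes for free, because \<open>-1\<close> is an element of the free ring.
\<close>

lemma ideal_free_ringI:
  assumes sub: "J \<subseteq> carrier (free_ring X)" and zero: "0 \<in> J"
    and add: "\<And>p q. p \<in> J \<Longrightarrow> q \<in> J \<Longrightarrow> p + q \<in> J"
    and left: "\<And>p q. p \<in> J \<Longrightarrow> q \<in> carrier (free_ring X) \<Longrightarrow> q * p \<in> J"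
    and right: "\<And>p q. p \<in> J \<Longrightarrow> q \<in> carrier (free_ring X) \<Longrightarrow> p * q \<in> J"
  shows "ideal J (free_ring X)"
proof (rule idealI[OF ring_free_ring])
  interpret ring "free_ring X" by (rule ring_free_ring)
  have neg: "- p \<in> J" if "p \<in> J" for p
    using left[OF that, of "- 1"] by auto
  show "subgroup J (add_monoid (free_ring X))"
  proof (rule group.subgroupI)
    show "Group.group (add_monoid (free_ring X))" by (rule a_group)
    fix p assume p: "p \<in> J"
    have "inv\<^bsub>add_monoid (free_ring X)\<^esub> p = - p"
      using p sub minus_equality[of "- p" p] by (auto simp: a_inv_def)
    then show "inv\<^bsub>add_monoid (free_ring X)\<^esub> p \<in> J" using neg[OF p] by simp
  qed (use sub zero add in auto)
qed (use left right in auto)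

section \<open>The free ring acting on functions\<close>

text \<open>
  The letters act as partial maps; the last letter of a word acts first, as for products of operators.
\<close>

primrec word_act :: "('g \<Rightarrow> 'x \<Rightarrow> 'x option) \<Rightarrow> 'g list \<Rightarrow> 'x \<Rightarrow> 'x option" where
  "word_act a [] x = Some x"
| "word_act a (g # gs) x = Option.bind (word_act a gs x) (a g)"

lemma word_act_append:
  "word_act a (us @ ws) x = Option.bind (word_act a ws x) (word_act a us)"
  by (induction us) auto

text \<open>
  The linear extension of partial maps, written contravariantly: a word sends a function \<open>h\<close> to its
  composition with the partial map of that word, extended by zero. Coefficients multiply the values
  of \<open>h\<close> from the right, so that the action respects products over a noncommutative ring as well.
\<close>

definition right_act ::
    "('g \<Rightarrow> 'x \<Rightarrow> 'x option) \<Rightarrow> ('x \<Rightarrow> 'r) \<Rightarrow> ('g free_word \<Rightarrow>\<^sub>0 'r::ring_1) \<Rightarrow> 'x \<Rightarrow> 'r" where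
  "right_act a h p x = (\<Sum>w\<in>Poly_Mapping.keys p.
     case_option 0 h (word_act a (letters w) x) * Poly_Mapping.lookup p w)"

lemma right_act_single [simp]:
  "right_act a h (Poly_Mapping.single w c) x = case_option 0 h (word_act a (letters w) x) * c"
  by (simp add: right_act_def)

lemma right_act_zero [simp]: "right_act a h 0 x = 0"
  by (simp add: right_act_def)

lemma right_act_add [simp]: "right_act a h (p + q) x = right_act a h p x + right_act a h q x"
  unfolding right_act_def
  by (rule setsum_keys_plus_distrib[where f = "\<lambda>w c. case_option 0 h (word_act a (letters w) x) * c"])
    (simp_all add: distrib_left)

lemma right_act_uminus [simp]: "right_act a h (- p) x = - right_act a h p x"
  by (simp add: right_act_def sum_negf)

lemma right_act_diff [simp]: "right_act a h (p - q) x = right_act a h p x - right_act a h q x"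
  using right_act_add[of a h p "- q" x] by simp

lemma right_act_sum: "right_act a h (sum p A) x = (\<Sum>i\<in>A. right_act a h (p i) x)"
  by (induction A rule: infinite_finite_induct) auto

lemma right_act_zero_fun [simp]: "right_act a (\<lambda>_. 0) p x = 0"
  unfolding right_act_def by (rule sum.neutral) (auto split: option.split)

lemma right_act_mult: "right_act a h (p * q) x = right_act a (right_act a h p) q x"
proof (induction q rule: poly_mapping_additive_induct)
  case (single u d)
  show ?case
  proof (induction p rule: poly_mapping_additive_induct)
    case (single w c)
    show ?case
      by (cases "word_act a (letters u) x")
        (auto simp: mult_single word_act_append mult.assoc)
  next
    case (add q r)
    then show ?case
      by (auto simp: distrib_right split: option.split)
  qed (auto split: option.split)
qed (auto simp: distrib_left)

text \<open>
  Therefore an action that satisfies a set of relations kills the whole ideal that they generate.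
\<close>

lemma ideal_annihilator:
  "ideal {p \<in> carrier (free_ring X). \<forall>h x. right_act a h p x = 0} (free_ring X)"
proof (rule ideal_free_ringI, goal_cases)
  case (5 p q)
  then have "right_act a h p = (\<lambda>_. 0)" for h by auto
  with 5 show ?case by (auto simp: right_act_mult)
qed (auto simp: right_act_mult)

section \<open>Homogeneous parts\<close>

lemma word_degree_simps [simp]:
  "word_degree (u + w) = word_degree u + word_degree w"
  "word_degree 0 = 0"
  "word_degree (Word []) = 0"
  "word_degree (Word (g # gs)) = gen_degree g + word_degree (Word gs)"
  by (simp_all add: word_degree_def)

definition hom_part :: "int \<Rightarrow> ('v, 'e, 'r::ring_1) lpa_free \<Rightarrow> ('v, 'e, 'r) lpa_free" where
  "hom_part n = Poly_Mapping.mapp (\<lambda>w c. c when word_degree w = n)"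

lemma lookup_hom_part:
  "Poly_Mapping.lookup (hom_part n p) w = (Poly_Mapping.lookup p w when word_degree w = n)"
  by (auto simp: hom_part_def lookup_mapp when_def in_keys_iff)

lemma hom_part_add: "hom_part n (p + q) = hom_part n p + hom_part n q"
  by (rule poly_mapping_eqI) (simp add: lookup_hom_part lookup_add when_add_distrib)

lemma hom_part_zero [simp]: "hom_part n 0 = 0"
  by (rule poly_mapping_eqI) (simp add: lookup_hom_part)

lemma hom_part_diff: "hom_part n (p - q) = hom_part n p - hom_part n q"
  by (rule poly_mapping_eqI) (simp add: lookup_hom_part lookup_minus when_def)

lemma hom_part_sum: "hom_part n (sum p A) = (\<Sum>i\<in>A. hom_part n (p i))"
  by (induction A rule: infinite_finite_induct) (auto simp: hom_part_add)

lemma keys_hom_part: "Poly_Mapping.keys (hom_part n p) = {w \<in> Poly_Mapping.keys p. word_degree w = n}"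
  by (auto simp: in_keys_iff lookup_hom_part)

lemma hom_part_homogeneous:
  assumes "\<And>w. w \<in> Poly_Mapping.keys p \<Longrightarrow> word_degree w = m"
  shows "hom_part n p = (if n = m then p else 0)"
  using assms
  by (intro poly_mapping_eqI) (auto simp: lookup_hom_part when_def in_keys_iff)

lemma sum_hom_parts:
  "p = (\<Sum>n\<in>word_degree ` Poly_Mapping.keys p. hom_part n p)"
  by (rule poly_mapping_eqI) (auto simp: lookup_sum lookup_hom_part when_def in_keys_iff)

lemma hom_part_single_mult:
  "hom_part n (Poly_Mapping.single w c * p) = Poly_Mapping.single w c * hom_part (n - word_degree w) p"
proof (induction p rule: poly_mapping_additive_induct)
  case (single u d)
  show ?case
    by (subst (1 2) hom_part_homogeneous)
      (auto simp: mult_single split: if_splits)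
qed (auto simp: distrib_left hom_part_add)

lemma hom_part_mult_single:
  "hom_part n (p * Poly_Mapping.single w c) = hom_part (n - word_degree w) p * Poly_Mapping.single w c"
proof (induction p rule: poly_mapping_additive_induct)
  case (single u d)
  show ?case
    by (subst (1 2) hom_part_homogeneous)
      (auto simp: mult_single split: if_splits)
qed (auto simp: distrib_right hom_part_add)

section \<open>The Leavitt path algebra as a quotient\<close>

lemma lpa_gens_iff [simp]:
  "Vertex v \<in> lpa_gens E \<longleftrightarrow> v \<in> verts E"
  "Edge f \<in> lpa_gens E \<longleftrightarrow> f \<in> arcs E"
  "Ghost f \<in> lpa_gens E \<longleftrightarrow> f \<in> arcs E"
  by (auto simp: lpa_gens_def)

context wf_digraph
begin

lemma relations_subset: "lpa_relations G \<subseteq> carrier (free_ring (lpa_gens G))"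
  unfolding lpa_relations_def
  by (intro Un_least subsetI; elim CollectE exE conjE; hypsubst)
    (auto intro!: free_ring_closed(4) free_ring_sum_closed single_mem_free_ring)

lemma ideal_lpa_ideal: "ideal (lpa_ideal G) (free_ring (lpa_gens G))"
  unfolding lpa_ideal_def by (rule ring.genideal_ideal[OF ring_free_ring relations_subset])

lemma relations_in_ideal: "lpa_relations G \<subseteq> lpa_ideal G"
  unfolding lpa_ideal_def by (rule ring.genideal_self[OF ring_free_ring relations_subset])

lemma lpa_ideal_minimal:
  "ideal J (free_ring (lpa_gens G)) \<Longrightarrow> lpa_relations G \<subseteq> J \<Longrightarrow> lpa_ideal G \<subseteq> J"
  unfolding lpa_ideal_def by (rule ring.genideal_minimal[OF ring_free_ring])

lemma lpa_ideal_closed: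
  shows "0 \<in> lpa_ideal G"
    and "p \<in> lpa_ideal G \<Longrightarrow> q \<in> lpa_ideal G \<Longrightarrow> p + q \<in> lpa_ideal G"
    and "p \<in> lpa_ideal G \<Longrightarrow> q \<in> carrier (free_ring (lpa_gens G)) \<Longrightarrow> q * p \<in> lpa_ideal G"
    and "p \<in> lpa_ideal G \<Longrightarrow> q \<in> carrier (free_ring (lpa_gens G)) \<Longrightarrow> p * q \<in> lpa_ideal G"
    and "p \<in> lpa_ideal G \<Longrightarrow> - p \<in> lpa_ideal G"
    and "p \<in> lpa_ideal G \<Longrightarrow> q \<in> lpa_ideal G \<Longrightarrow> p - q \<in> lpa_ideal G"
proof -
  note additive = ideal.axioms(1)[OF ideal_lpa_ideal]
  show "0 \<in> lpa_ideal G"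
    using additive_subgroup.zero_closed[OF additive] by simp
  have add: "p + q \<in> lpa_ideal G" if "p \<in> lpa_ideal G" "q \<in> lpa_ideal G" for p q
    using additive_subgroup.a_closed[OF additive that] by simp
  have left: "q * p \<in> lpa_ideal G"
    if "p \<in> lpa_ideal G" "q \<in> carrier (free_ring (lpa_gens G))" for p q
    using ideal.I_l_closed[OF ideal_lpa_ideal that] by simp
  show "p * q \<in> lpa_ideal G"
    if "p \<in> lpa_ideal G" "q \<in> carrier (free_ring (lpa_gens G))"
    using ideal.I_r_closed[OF ideal_lpa_ideal that] by simp
  have neg: "- p \<in> lpa_ideal G" if "p \<in> lpa_ideal G" for p
    using left[OF that, of "- 1"] by simp
  show "p - q \<in> lpa_ideal G" if "p \<in> lpa_ideal G" "q \<in> lpa_ideal G"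
    using add[OF that(1) neg[OF that(2)]] by simp
  show "p + q \<in> lpa_ideal G" if "p \<in> lpa_ideal G" "q \<in> lpa_ideal G"
    using that by (rule add)
  show "q * p \<in> lpa_ideal G" if "p \<in> lpa_ideal G" "q \<in> carrier (free_ring (lpa_gens G))"
    using that by (rule left)
  show "- p \<in> lpa_ideal G" if "p \<in> lpa_ideal G"
    using that by (rule neg)
qed

lemma lpa_ideal_sum:
  "(\<And>i. i \<in> A \<Longrightarrow> p i \<in> lpa_ideal G) \<Longrightarrow> sum p A \<in> lpa_ideal G"
  by (induction A rule: infinite_finite_induct) (simp_all add: lpa_ideal_closed(1,2))

lemma lpa_class_eq: "lpa_class G p = {p' + p | p'. p' \<in> lpa_ideal G}"
  by (auto simp: lpa_class_def a_r_coset_def')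

lemma lpa_class_eq_iff: "lpa_class G p = lpa_class G q \<longleftrightarrow> p - q \<in> lpa_ideal G"
proof
  assume "lpa_class G p = lpa_class G q"
  moreover have "p \<in> lpa_class G p"
    unfolding lpa_class_eq using lpa_ideal_closed(1) by force
  ultimately show "p - q \<in> lpa_ideal G"
    by (auto simp: lpa_class_eq)
next
  assume I: "p - q \<in> lpa_ideal G"
  have "i + p = (i + (p - q)) + q \<and> i + q = (i - (p - q)) + p" for i by simp
  then show "lpa_class G p = lpa_class G q"
    unfolding lpa_class_eq using I lpa_ideal_closed(2,6) by blast
qed

lemma lpa_class_zero: "lpa_class G 0 = lpa_ideal G"
  by (simp add: lpa_class_eq)

text \<open>
  The free nonunital algebra, whose classes make up the Leavitt path algebra.
\<close>

definition nonconstant :: "('a, 'b, 'r::ring_1) lpa_free set" where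
  "nonconstant = {p \<in> carrier (free_ring (lpa_gens G)). Poly_Mapping.lookup p 0 = 0}"

lemma nonconstantD [dest]: "p \<in> nonconstant \<Longrightarrow> p \<in> carrier (free_ring (lpa_gens G))"
  by (simp add: nonconstant_def)

lemma nonconstant_closed:
  shows "0 \<in> nonconstant"
    and "p \<in> nonconstant \<Longrightarrow> q \<in> nonconstant \<Longrightarrow> p + q \<in> nonconstant"
    and "p \<in> nonconstant \<Longrightarrow> - p \<in> nonconstant"
    and "p \<in> nonconstant \<Longrightarrow> q \<in> nonconstant \<Longrightarrow> p * q \<in> nonconstant"
proof -
  assume pq: "p \<in> nonconstant" "q \<in> nonconstant"
  have "0 \<notin> Poly_Mapping.keys (p * q)"
  proof
    assume "0 \<in> Poly_Mapping.keys (p * q)"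
    then obtain u w where "0 = u + w" "u \<in> Poly_Mapping.keys p"
      using keys_mult[of p q] by blast
    then have "0 \<in> Poly_Mapping.keys p" by (metis plus_eq_0_free_word)
    with pq show False by (simp add: nonconstant_def in_keys_iff)
  qed
  with pq show "p * q \<in> nonconstant"
    by (simp add: nonconstant_def in_keys_iff free_ring_closed)
qed (simp_all add: nonconstant_def lookup_add free_ring_closed)

lemma carrier_lpa: "carrier (leavitt_path_algebra G) = lpa_class G ` nonconstant"
  by (simp add: leavitt_path_algebra_def nonconstant_def)

lemma lpa_class_in_carrier:
  "p \<in> nonconstant \<Longrightarrow> lpa_class G p \<in> carrier (leavitt_path_algebra G)"
  by (simp add: carrier_lpa)

lemma zero_lpa: "\<zero>\<^bsub>leavitt_path_algebra G\<^esub> = lpa_class G 0"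
  by (simp add: leavitt_path_algebra_def FactRing_def lpa_class_zero)

lemma add_lpa:
  fixes p q :: "('a, 'b, 'r::ring_1) lpa_free"
  shows "lpa_class G p \<oplus>\<^bsub>leavitt_path_algebra G\<^esub> lpa_class G q = lpa_class G (p + q)"
proof -
  have "(\<Union>x\<in>lpa_class G p. \<Union>y\<in>lpa_class G q. {x + y}) = lpa_class G (p + q)"
  proof (intro equalityI subsetI)
    fix x assume "x \<in> (\<Union>x\<in>lpa_class G p. \<Union>y\<in>lpa_class G q. {x + y})"
    then obtain i j where "i \<in> lpa_ideal G" "j \<in> lpa_ideal G" "x = (i + j) + (p + q)"
      by (auto simp: lpa_class_eq algebra_simps)
    then show "x \<in> lpa_class G (p + q)"
      using lpa_ideal_closed(2) by (auto simp: lpa_class_eq)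
  next
    fix x assume "x \<in> lpa_class G (p + q)"
    then obtain i where i: "i \<in> lpa_ideal G" "x = (i + p) + (0 + q)"
      by (auto simp: lpa_class_eq algebra_simps)
    then have "i + p \<in> lpa_class G p" "0 + q \<in> lpa_class G q"
      unfolding lpa_class_eq using lpa_ideal_closed(1) by blast+
    then show "x \<in> (\<Union>x\<in>lpa_class G p. \<Union>y\<in>lpa_class G q. {x + y})"
      using i by blast
  qed
  then show ?thesis
    by (simp add: leavitt_path_algebra_def FactRing_def set_add_defs)
qed

lemma mult_lpa:
  assumes "p \<in> carrier (free_ring (lpa_gens G))" "q \<in> carrier (free_ring (lpa_gens G))"
  shows "lpa_class G p \<otimes>\<^bsub>leavitt_path_algebra G\<^esub> lpa_class G q = lpa_class G (p * q)"
  using ideal.rcoset_mult_add[OF ideal_lpa_ideal assms]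
  by (simp add: leavitt_path_algebra_def FactRing_def lpa_class_def)

text \<open>
  All laws are inherited from the free ring, as the class map respects sums and products.
\<close>

lemma nonunital_ring_lpa: "nonunital_ring (leavitt_path_algebra G)"
  unfolding nonunital_ring_def nonunital_ring_axioms_def
proof (intro conjI allI impI abelian_groupI)
  fix x assume "x \<in> carrier (leavitt_path_algebra G)"
  then obtain p where "p \<in> nonconstant" "x = lpa_class G p" by (auto simp: carrier_lpa)
  then show "\<exists>y\<in>carrier (leavitt_path_algebra G).
      y \<oplus>\<^bsub>leavitt_path_algebra G\<^esub> x = \<zero>\<^bsub>leavitt_path_algebra G\<^esub>"
    by (intro bexI[of _ "lpa_class G (- p)"])
      (simp_all add: carrier_lpa add_lpa zero_lpa nonconstant_closed)
qed (auto simp: carrier_lpa add_lpa zero_lpa mult_lpa nonconstantD nonconstant_closed algebra_simps)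

lemma finsum_lpa:
  assumes "finite A" "\<And>i. i \<in> A \<Longrightarrow> p i \<in> nonconstant"
  shows "(\<Oplus>\<^bsub>leavitt_path_algebra G\<^esub>i\<in>A. lpa_class G (p i)) = lpa_class G (sum p A)"
proof -
  interpret nonunital_ring "leavitt_path_algebra G" by (rule nonunital_ring_lpa)
  show ?thesis
    using assms
  proof (induction A rule: finite_induct)
    case empty
    show ?case by (simp add: zero_lpa)
  next
    case (insert i A)
    then show ?case
      by (subst finsum_insert) (auto simp: carrier_lpa add_lpa)
  qed
qed

section \<open>The gradation\<close>

definition homogeneous :: "int \<Rightarrow> ('a, 'b, 'r::ring_1) lpa_free set" where
  "homogeneous n = {p \<in> nonconstant. \<forall>w\<in>Poly_Mapping.keys p. word_degree w = n}"

lemma homogeneousD [dest]: "p \<in> homogeneous n \<Longrightarrow> p \<in> nonconstant"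
  by (simp add: homogeneous_def)

lemma lpa_component_eq: "lpa_component G n = lpa_class G ` homogeneous n"
  by (simp add: lpa_component_def homogeneous_def nonconstant_def conj_assoc)

lemma homogeneous_closed:
  shows "0 \<in> homogeneous n"
    and "p \<in> homogeneous n \<Longrightarrow> q \<in> homogeneous n \<Longrightarrow> p + q \<in> homogeneous n"
    and "p \<in> homogeneous n \<Longrightarrow> - p \<in> homogeneous n"
  using keys_add[of p q] by (auto simp: homogeneous_def nonconstant_closed dest!: subsetD)

lemma homogeneous_mult:
  assumes "p \<in> homogeneous m" "q \<in> homogeneous n"
  shows "p * q \<in> homogeneous (m + n)"
proof -
  have "word_degree w = m + n" if w: "w \<in> Poly_Mapping.keys (p * q)" for w
  proof -
    obtain u v where "w = u + v" "u \<in> Poly_Mapping.keys p" "v \<in> Poly_Mapping.keys q"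
      using keys_mult[of p q] w by blast
    with assms show ?thesis by (simp add: homogeneous_def)
  qed
  with assms show ?thesis by (simp add: homogeneous_def nonconstant_closed)
qed

lemma homogeneous_sum:
  "(\<And>i. i \<in> A \<Longrightarrow> p i \<in> homogeneous n) \<Longrightarrow> sum p A \<in> homogeneous n"
  by (induction A rule: infinite_finite_induct) (simp_all add: homogeneous_closed)

lemma hom_part_in_homogeneous: "p \<in> nonconstant \<Longrightarrow> hom_part n p \<in> homogeneous n"
  by (auto simp: homogeneous_def nonconstant_def mem_free_ring keys_hom_part lookup_hom_part)

lemma hom_part_of_homogeneous:
  "p \<in> homogeneous m \<Longrightarrow> hom_part n p = (if n = m then p else 0)"
  by (rule hom_part_homogeneous) (simp add: homogeneous_def)

lemma relation_homogeneous:
  fixes r :: "('a, 'b, 'r::ring_1) lpa_free"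
  assumes "r \<in> lpa_relations G"
  obtains n where "\<And>w. w \<in> Poly_Mapping.keys r \<Longrightarrow> word_degree w = n"
proof -
  have diff: "\<forall>w\<in>Poly_Mapping.keys (p - q). word_degree w = n"
    if "\<forall>w\<in>Poly_Mapping.keys p. word_degree w = n" "\<forall>w\<in>Poly_Mapping.keys q. word_degree w = n"
    for p q :: "('a, 'b, 'r) lpa_free" and n
    using keys_diff[of p q] that by blast
  have sum: "\<forall>w\<in>Poly_Mapping.keys (\<Sum>f\<in>A. word [Edge f, Ghost f] :: ('a, 'b, 'r) lpa_free).
      word_degree w = 0" for A
    using keys_sum[of "\<lambda>f. word [Edge f, Ghost f] :: ('a, 'b, 'r) lpa_free" A] by fastforce
  have "r \<in> lpa_relations G \<longrightarrow> (\<exists>n. \<forall>w\<in>Poly_Mapping.keys r. word_degree w = n)"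
    unfolding lpa_relations_def
    by (intro impI; elim UnE CollectE exE conjE; hypsubst; intro exI diff; (rule sum)?) auto
  then show ?thesis using assms that by blast
qed

text \<open>
  The elements all of whose homogeneous parts lie in the ideal again form an ideal, since multiplication
  by a term only shifts the degree of the parts. It contains the relations, which are homogeneous, and
  therefore everything.
\<close>

lemma hom_part_in_ideal:
  fixes p :: "('a, 'b, 'r::ring_1) lpa_free"
  assumes "p \<in> lpa_ideal G"
  shows "hom_part n p \<in> lpa_ideal G"
proof -
  define J :: "('a, 'b, 'r) lpa_free set"
    where "J = {p \<in> carrier (free_ring (lpa_gens G)). \<forall>n. hom_part n p \<in> lpa_ideal G}"
  have "ideal J (free_ring (lpa_gens G))"
  proof (rule ideal_free_ringI)
    fix p q :: "('a, 'b, 'r) lpa_free"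
    assume p: "p \<in> J" and q: "q \<in> carrier (free_ring (lpa_gens G))"
    have single: "Poly_Mapping.single w c \<in> carrier (free_ring (lpa_gens G))"
      if "w \<in> Poly_Mapping.keys q" for w and c :: 'r
      using q that by (auto simp: mem_free_ring)
    have "\<forall>n. hom_part n (q * p) \<in> lpa_ideal G"
    proof (rule poly_mapping_additive_induct[where P = "\<lambda>q. \<forall>n. hom_part n (q * p) \<in> lpa_ideal G"])
    qed (use p single in \<open>simp_all add: J_def distrib_right hom_part_add hom_part_single_mult
        lpa_ideal_closed\<close>)
    then show "q * p \<in> J" using p q by (simp add: J_def)
    have "\<forall>n. hom_part n (p * q) \<in> lpa_ideal G"
    proof (rule poly_mapping_additive_induct[where P = "\<lambda>q. \<forall>n. hom_part n (p * q) \<in> lpa_ideal G"])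
    qed (use p single in \<open>simp_all add: J_def distrib_left hom_part_add hom_part_mult_single
        lpa_ideal_closed\<close>)
    then show "p * q \<in> J" using p q by (simp add: J_def)
  qed (auto simp: J_def hom_part_add lpa_ideal_closed)
  moreover have "lpa_relations G \<subseteq> J"
  proof
    fix r :: "('a, 'b, 'r) lpa_free" assume r: "r \<in> lpa_relations G"
    obtain m where "\<And>w. w \<in> Poly_Mapping.keys r \<Longrightarrow> word_degree w = m"
      using relation_homogeneous[OF r] by blast
    then have "hom_part n r = (if n = m then r else 0)" for n
      by (rule hom_part_homogeneous)
    then show "r \<in> J"
      using r relations_subset relations_in_ideal by (auto simp: J_def lpa_ideal_closed(1))
  qed
  ultimately show ?thesis
    using lpa_ideal_minimal assms by (fastforce simp: J_def)
qed

text \<open>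
  The counterpart of \<^const>\<open>sums_of_products\<close> for representatives.
\<close>

definition prod_sums ::
    "('a, 'b, 'r::ring_1) lpa_free set \<Rightarrow> ('a, 'b, 'r) lpa_free set \<Rightarrow> ('a, 'b, 'r) lpa_free set" where
  "prod_sums A B = {\<Sum>i<k. a i * b i | (k :: nat) a b. \<forall>i<k. a i \<in> A \<and> b i \<in> B}"

lemma sums_of_products_lpa:
  fixes A B :: "('a, 'b, 'r::ring_1) lpa_free set"
  assumes "A \<subseteq> nonconstant" "B \<subseteq> nonconstant"
  shows "sums_of_products (leavitt_path_algebra G) (lpa_class G ` A) (lpa_class G ` B) =
    lpa_class G ` prod_sums A B"
proof -
  interpret nonunital_ring "leavitt_path_algebra G" by (rule nonunital_ring_lpa)
  have sum: "(\<Oplus>\<^bsub>leavitt_path_algebra G\<^esub>i\<in>{..<k}.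
        lpa_class G (a i) \<otimes>\<^bsub>leavitt_path_algebra G\<^esub> lpa_class G (b i)) =
      lpa_class G (\<Sum>i<k. a i * b i)"
    if "\<forall>i<k. a i \<in> A \<and> b i \<in> B" for k :: nat and a b
  proof -
    have ab: "a i \<in> nonconstant" "b i \<in> nonconstant" if "i < k" for i
      using \<open>\<forall>i<k. a i \<in> A \<and> b i \<in> B\<close> that assms by auto
    have "(\<Oplus>\<^bsub>leavitt_path_algebra G\<^esub>i\<in>{..<k}.
        lpa_class G (a i) \<otimes>\<^bsub>leavitt_path_algebra G\<^esub> lpa_class G (b i)) =
      (\<Oplus>\<^bsub>leavitt_path_algebra G\<^esub>i\<in>{..<k}. lpa_class G (a i * b i))"
      using ab by (intro finsum_cong') (simp_all add: mult_lpa lpa_class_in_carrier nonconstant_closed nonconstantD)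
    also have "\<dots> = lpa_class G (\<Sum>i<k. a i * b i)"
      using ab by (intro finsum_lpa) (auto simp: nonconstant_closed)
    finally show ?thesis .
  qed
  show ?thesis
  proof (intro equalityI subsetI)
    fix x assume "x \<in> sums_of_products (leavitt_path_algebra G) (lpa_class G ` A) (lpa_class G ` B)"
    then obtain k :: nat and a b where
      x: "x = (\<Oplus>\<^bsub>leavitt_path_algebra G\<^esub>i\<in>{..<k}. a i \<otimes>\<^bsub>leavitt_path_algebra G\<^esub> b i)"
      and ab: "\<forall>i<k. a i \<in> lpa_class G ` A \<and> b i \<in> lpa_class G ` B"
      unfolding sums_of_products_def by blast
    from ab have "\<forall>i. \<exists>a' b'. i < k \<longrightarrow>
        a i = lpa_class G a' \<and> a' \<in> A \<and> b i = lpa_class G b' \<and> b' \<in> B" by blast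
    then obtain a' b' where ab': "\<And>i. i < k \<Longrightarrow>
        a i = lpa_class G (a' i) \<and> a' i \<in> A \<and> b i = lpa_class G (b' i) \<and> b' i \<in> B" by metis
    have ab'': "a' i \<in> nonconstant" "b' i \<in> nonconstant" if "i < k" for i
      using ab'[OF that] assms by auto
    have "x = (\<Oplus>\<^bsub>leavitt_path_algebra G\<^esub>i\<in>{..<k}.
        lpa_class G (a' i) \<otimes>\<^bsub>leavitt_path_algebra G\<^esub> lpa_class G (b' i))"
      unfolding x using ab' ab'' by (intro finsum_cong') (simp_all add: mult_lpa lpa_class_in_carrier nonconstant_closed nonconstantD)
    also have "\<dots> = lpa_class G (\<Sum>i<k. a' i * b' i)" using ab' by (intro sum) auto
    finally show "x \<in> lpa_class G ` prod_sums A B"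
      using ab' unfolding prod_sums_def by blast
  next
    fix x assume "x \<in> lpa_class G ` prod_sums A B"
    then obtain k :: nat and a b where "x = lpa_class G (\<Sum>i<k. a i * b i)"
      and ab: "\<forall>i<k. a i \<in> A \<and> b i \<in> B"
      unfolding prod_sums_def by blast
    then have "x = (\<Oplus>\<^bsub>leavitt_path_algebra G\<^esub>i\<in>{..<k}.
        lpa_class G (a i) \<otimes>\<^bsub>leavitt_path_algebra G\<^esub> lpa_class G (b i))"
      using sum by simp
    then show "x \<in> sums_of_products (leavitt_path_algebra G) (lpa_class G ` A) (lpa_class G ` B)"
      unfolding sums_of_products_def using ab
      by (intro CollectI exI[of _ k] exI[of _ "\<lambda>i. lpa_class G (a i)"]
          exI[of _ "\<lambda>i. lpa_class G (b i)"]) auto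
  qed
qed

lemma sums_of_products_components:
  "sums_of_products (leavitt_path_algebra G) (lpa_component G m) (lpa_component G n) =
    lpa_class G ` prod_sums (homogeneous m) (homogeneous n)"
  unfolding lpa_component_eq by (rule sums_of_products_lpa) auto

lemma prod_sums_homogeneous: "prod_sums (homogeneous m) (homogeneous n) \<subseteq> homogeneous (m + n)"
  by (auto simp: prod_sums_def intro!: homogeneous_sum homogeneous_mult)

text \<open>
  Homogeneous parts of a representative give the decomposition. It is unique because two
  representatives of a class differ by an element of the ideal, whose parts are in the ideal as well.
\<close>

lemma Z_graded_ring_lpa:
  "Z_graded_ring (leavitt_path_algebra G :: ('a, 'b, 'r::ring_1) lpa_free set ring) (lpa_component G)"
proof -
  interpret L: nonunital_ring "leavitt_path_algebra G :: ('a, 'b, 'r) lpa_free set ring"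
    by (rule nonunital_ring_lpa)
  note closed = homogeneous_closed lpa_class_in_carrier imageI nonconstant_closed homogeneousD
  show ?thesis
  proof (unfold_locales, goal_cases)
    case (1 n)
    show ?case by (auto simp: lpa_component_eq carrier_lpa)
  next
    case (2 n x y)
    then show ?case by (auto simp: lpa_component_eq add_lpa closed)
  next
    case (3 n)
    show ?case by (auto simp: lpa_component_eq zero_lpa closed)
  next
    case (4 n x)
    then obtain q where q: "q \<in> homogeneous n" "x = lpa_class G q" by (auto simp: lpa_component_eq)
    then have "\<ominus>\<^bsub>leavitt_path_algebra G\<^esub> x = lpa_class G (- q)"
      by (intro L.minus_equality) (simp_all add: add_lpa zero_lpa closed)
    with q show ?case by (auto simp: lpa_component_eq a_inv_def closed)
  next
    case (5 x)
    then obtain p :: "('a, 'b, 'r) lpa_free"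
      where p: "p \<in> nonconstant" "x = lpa_class G p" by (auto simp: carrier_lpa)
    (* A nonzero part of p may lie in the ideal, so the support of the family of classes can be
       smaller than the set of degrees that occur in p. *)
    let ?D = "word_degree ` Poly_Mapping.keys p"
    let ?S = "{n. lpa_class G (hom_part n p) \<noteq> \<zero>\<^bsub>leavitt_path_algebra G\<^esub>}"
    have "hom_part n p = 0" if "n \<notin> ?D" for n
      using that unfolding keys_eq_empty[symmetric] keys_hom_part by auto
    then have S: "?S \<subseteq> ?D" by (auto simp: zero_lpa)
    then have fin: "finite ?S" by (rule finite_subset) simp
    have nonconst: "hom_part n p \<in> nonconstant" for n
      using hom_part_in_homogeneous[OF p(1), of n] by auto
    show ?case
    proof (rule ex1I[of _ "\<lambda>n. lpa_class G (hom_part n p)"], intro conjI allI)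
      fix n show "lpa_class G (hom_part n p) \<in> lpa_component G n"
        using p by (auto simp: lpa_component_eq intro: hom_part_in_homogeneous)
    next
      show "finite ?S" by (rule fin)
    next
      have "p - (\<Sum>n\<in>?S. hom_part n p) = (\<Sum>n\<in>?D - ?S. hom_part n p)"
        using sum.subset_diff[OF S, of "\<lambda>n. hom_part n p"] sum_hom_parts[of p]
        by (simp add: diff_eq_eq)
      also have "\<dots> \<in> lpa_ideal G"
        by (rule lpa_ideal_sum) (auto simp: zero_lpa lpa_class_eq_iff)
      finally have "lpa_class G p = lpa_class G (\<Sum>n\<in>?S. hom_part n p)"
        by (simp add: lpa_class_eq_iff)
      also have "\<dots> = (\<Oplus>\<^bsub>leavitt_path_algebra G\<^esub>n\<in>?S. lpa_class G (hom_part n p))"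
        by (rule finsum_lpa[symmetric, OF fin nonconst])
      finally show "x = (\<Oplus>\<^bsub>leavitt_path_algebra G\<^esub>n\<in>?S. lpa_class G (hom_part n p))"
        using p by simp
    next
      fix c :: "int \<Rightarrow> ('a, 'b, 'r) lpa_free set"
      let ?T = "{n. c n \<noteq> \<zero>\<^bsub>leavitt_path_algebra G\<^esub>}"
      assume "(\<forall>n. c n \<in> lpa_component G n) \<and> finite ?T \<and>
        x = (\<Oplus>\<^bsub>leavitt_path_algebra G\<^esub>n\<in>?T. c n)"
      then have c: "\<forall>n. c n \<in> lpa_component G n" and fin: "finite ?T"
        and x: "x = (\<Oplus>\<^bsub>leavitt_path_algebra G\<^esub>n\<in>?T. c n)"
        by blast+
      from c have "\<forall>n. \<exists>q. q \<in> homogeneous n \<and> c n = lpa_class G q"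
        by (auto simp: lpa_component_eq)
      then obtain q where q: "\<And>n. q n \<in> homogeneous n" and cq: "c = (\<lambda>n. lpa_class G (q n))"
        by metis
      have "lpa_class G p = lpa_class G (sum q ?T)"
        unfolding p(2)[symmetric] x unfolding cq
        by (rule finsum_lpa) (use fin q in \<open>auto simp: cq\<close>)
      then have I: "p - sum q ?T \<in> lpa_ideal G" by (simp add: lpa_class_eq_iff)
      show "c = (\<lambda>n. lpa_class G (hom_part n p))"
      proof
        fix n
        have "hom_part n (sum q ?T) = (\<Sum>m\<in>?T. if n = m then q m else 0)"
          using q by (auto simp: hom_part_sum hom_part_of_homogeneous intro!: sum.cong)
        also have "\<dots> = (if n \<in> ?T then q n else 0)"
          using fin by (simp add: sum.delta')
        finally have "lpa_class G (hom_part n (sum q ?T)) = c n"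
          by (simp add: cq zero_lpa)
        moreover have "hom_part n p - hom_part n (sum q ?T) \<in> lpa_ideal G"
          using hom_part_in_ideal[OF I, of n] by (simp add: hom_part_diff)
        ultimately show "c n = lpa_class G (hom_part n p)"
          by (simp add: lpa_class_eq_iff[symmetric])
      qed
    qed
  next
    case (6 m n)
    show ?case
      unfolding sums_of_products_components unfolding lpa_component_eq
      by (rule image_mono) (rule prod_sums_homogeneous)
  qed
qed

section \<open>Graphs without sinks\<close>

lemma prod_sums_product: "a \<in> A \<Longrightarrow> b \<in> B \<Longrightarrow> a * b \<in> prod_sums A B"
  unfolding prod_sums_def
  by (intro CollectI exI[of _ 1] exI[of _ "\<lambda>_. a"] exI[of _ "\<lambda>_. b"]) simp

lemma prod_sums_zero: "0 \<in> prod_sums A B"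
  unfolding prod_sums_def by (intro CollectI exI[of _ 0]) simp

lemma prod_sums_add:
  assumes "p \<in> prod_sums A B" "q \<in> prod_sums A B"
  shows "p + q \<in> prod_sums A B"
proof -
  obtain k :: nat and a b where p: "p = (\<Sum>i<k. a i * b i)" "\<forall>i<k. a i \<in> A \<and> b i \<in> B"
    using assms(1) unfolding prod_sums_def by blast
  obtain l :: nat and c d where q: "q = (\<Sum>i<l. c i * d i)" "\<forall>i<l. c i \<in> A \<and> d i \<in> B"
    using assms(2) unfolding prod_sums_def by blast
  let ?x = "\<lambda>i. if i < k then a i else c (i - k)" and ?y = "\<lambda>i. if i < k then b i else d (i - k)"
  have "(\<Sum>i<k + l. ?x i * ?y i) = p + q"
    unfolding p q by (induction l) simp_all
  moreover have "\<forall>i<k + l. ?x i \<in> A \<and> ?y i \<in> B"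
    using p q by auto
  ultimately show ?thesis
    unfolding prod_sums_def by (intro CollectI exI[of _ "k + l"] exI[of _ ?x] exI[of _ ?y]) simp
qed

lemma prod_sums_mult_left:
  assumes "p \<in> prod_sums (homogeneous m) (homogeneous n)" "x \<in> homogeneous k"
  shows "x * p \<in> prod_sums (homogeneous (k + m)) (homogeneous n)"
proof -
  obtain l :: nat and a b where p: "p = (\<Sum>i<l. a i * b i)"
    "\<forall>i<l. a i \<in> homogeneous m \<and> b i \<in> homogeneous n"
    using assms(1) unfolding prod_sums_def by blast
  have "x * p = (\<Sum>i<l. (x * a i) * b i)"
    by (simp add: p sum_distrib_left mult.assoc)
  moreover have "\<forall>i<l. x * a i \<in> homogeneous (k + m) \<and> b i \<in> homogeneous n"
    using p assms(2) by (simp add: homogeneous_mult)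
  ultimately show ?thesis
    unfolding prod_sums_def by (intro CollectI exI[of _ l] exI[of _ "\<lambda>i. x * a i"] exI[of _ b]) simp
qed

lemma prod_sums_mult_right:
  assumes "p \<in> prod_sums (homogeneous m) (homogeneous n)" "x \<in> homogeneous k"
  shows "p * x \<in> prod_sums (homogeneous m) (homogeneous (n + k))"
proof -
  obtain l :: nat and a b where p: "p = (\<Sum>i<l. a i * b i)"
    "\<forall>i<l. a i \<in> homogeneous m \<and> b i \<in> homogeneous n"
    using assms(1) unfolding prod_sums_def by blast
  have "p * x = (\<Sum>i<l. a i * (b i * x))"
    by (simp add: p sum_distrib_right mult.assoc)
  moreover have "\<forall>i<l. a i \<in> homogeneous m \<and> b i * x \<in> homogeneous (n + k)"
    using p assms(2) by (simp add: homogeneous_mult)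
  ultimately show ?thesis
    unfolding prod_sums_def by (intro CollectI exI[of _ l] exI[of _ a] exI[of _ "\<lambda>i. b i * x"]) simp
qed

text \<open>
  Representatives of the elements of \<open>S\<^sub>m S\<^sub>n\<close>.
\<close>

definition factorizable :: "int \<Rightarrow> int \<Rightarrow> ('a, 'b, 'r::ring_1) lpa_free set" where
  "factorizable m n =
    {p. \<exists>q \<in> prod_sums (homogeneous m) (homogeneous n). p - q \<in> lpa_ideal G}"

lemma factorizable_cong:
  assumes "p \<in> factorizable m n" "p - p' \<in> lpa_ideal G"
  shows "p' \<in> factorizable m n"
proof -
  obtain q where "q \<in> prod_sums (homogeneous m) (homogeneous n)" "p - q \<in> lpa_ideal G"
    using assms(1) unfolding factorizable_def by blast
  then show ?thesis
    using lpa_ideal_closed(6)[of "p - q" "p - p'"] assms(2)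
    by (auto simp: factorizable_def)
qed

lemma factorizable_product:
  "a \<in> homogeneous m \<Longrightarrow> b \<in> homogeneous n \<Longrightarrow> a * b \<in> factorizable m n"
  by (auto simp: factorizable_def prod_sums_product lpa_ideal_closed(1)
      intro!: bexI[of _ "a * b"])

lemma factorizable_zero: "0 \<in> factorizable m n"
  by (auto simp: factorizable_def prod_sums_zero lpa_ideal_closed(1) intro!: bexI[of _ 0])

lemma factorizable_add:
  assumes "p \<in> factorizable m n" "q \<in> factorizable m n"
  shows "p + q \<in> factorizable m n"
proof -
  obtain p' q' where "p' \<in> prod_sums (homogeneous m) (homogeneous n)" "p - p' \<in> lpa_ideal G"
    and "q' \<in> prod_sums (homogeneous m) (homogeneous n)" "q - q' \<in> lpa_ideal G"
    using assms unfolding factorizable_def by blast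
  moreover have "p + q - (p' + q') \<in> lpa_ideal G"
    using lpa_ideal_closed(2)[OF calculation(2,4)] by (simp add: algebra_simps)
  ultimately show ?thesis
    using prod_sums_add unfolding factorizable_def by blast
qed

lemma factorizable_sum:
  "(\<And>i. i \<in> A \<Longrightarrow> p i \<in> factorizable m n) \<Longrightarrow> sum p A \<in> factorizable m n"
  by (induction A rule: infinite_finite_induct) (simp_all add: factorizable_zero factorizable_add)

lemma factorizable_mult_left:
  assumes "p \<in> factorizable m n" "x \<in> homogeneous k"
  shows "x * p \<in> factorizable (k + m) n"
proof -
  obtain q where "q \<in> prod_sums (homogeneous m) (homogeneous n)" "p - q \<in> lpa_ideal G"
    using assms(1) unfolding factorizable_def by blast
  moreover from this(2) have "x * p - x * q \<in> lpa_ideal G"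
    unfolding right_diff_distrib[symmetric]
    by (rule lpa_ideal_closed(3)) (rule nonconstantD[OF homogeneousD[OF assms(2)]])
  ultimately show ?thesis
    using prod_sums_mult_left assms(2) unfolding factorizable_def by blast
qed

lemma factorizable_mult_right:
  assumes "p \<in> factorizable m n" "x \<in> homogeneous k"
  shows "p * x \<in> factorizable m (n + k)"
proof -
  obtain q where "q \<in> prod_sums (homogeneous m) (homogeneous n)" "p - q \<in> lpa_ideal G"
    using assms(1) unfolding factorizable_def by blast
  moreover from this(2) have "p * x - q * x \<in> lpa_ideal G"
    unfolding left_diff_distrib[symmetric]
    by (rule lpa_ideal_closed(4)) (rule nonconstantD[OF homogeneousD[OF assms(2)]])
  ultimately show ?thesis
    using prod_sums_mult_right assms(2) unfolding factorizable_def by blast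
qed

lemma single_homogeneous:
  assumes "set (letters w) \<subseteq> lpa_gens G" "letters w \<noteq> []"
  shows "Poly_Mapping.single w c \<in> homogeneous (word_degree w)"
proof -
  have "w \<noteq> 0" using assms(2) by auto
  with assms(1) show ?thesis
    by (simp add: homogeneous_def nonconstant_def single_mem_free_ring lookup_single)
qed

lemma gen_homogeneous:
  "v \<in> verts G \<Longrightarrow> word [Vertex v] \<in> homogeneous 0"
  "f \<in> arcs G \<Longrightarrow> word [Edge f] \<in> homogeneous 1"
  "f \<in> arcs G \<Longrightarrow> word [Ghost f] \<in> homogeneous (- 1)"
  using single_homogeneous[of "Word [Vertex v]" 1] single_homogeneous[of "Word [Edge f]" 1]
    single_homogeneous[of "Word [Ghost f]" 1] by simp_all

lemma relation_congruences:
  shows "v \<in> verts G \<Longrightarrow> word [Vertex v, Vertex v] - word [Vertex v] \<in> lpa_ideal G"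
    and "f \<in> arcs G \<Longrightarrow> word [Vertex (tail G f), Edge f] - word [Edge f] \<in> lpa_ideal G"
    and "f \<in> arcs G \<Longrightarrow> word [Edge f, Vertex (head G f)] - word [Edge f] \<in> lpa_ideal G"
    and "f \<in> arcs G \<Longrightarrow> word [Vertex (head G f), Ghost f] - word [Ghost f] \<in> lpa_ideal G"
    and "f \<in> arcs G \<Longrightarrow> word [Ghost f, Vertex (tail G f)] - word [Ghost f] \<in> lpa_ideal G"
    and "f \<in> arcs G \<Longrightarrow> word [Ghost f, Edge f] - word [Vertex (head G f)] \<in> lpa_ideal G"
    and "v \<in> verts G \<Longrightarrow> out_arcs G v \<noteq> {} \<Longrightarrow> finite (out_arcs G v) \<Longrightarrow>
      (\<Sum>f\<in>out_arcs G v. word [Edge f, Ghost f]) - word [Vertex v] \<in> lpa_ideal G"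
proof -
  note relation = subsetD[OF relations_in_ideal]
  show "word [Vertex v, Vertex v] - word [Vertex v] \<in> lpa_ideal G" if "v \<in> verts G"
  proof (rule relation)
    have "word [Vertex v, Vertex v] - (if v = v then word [Vertex v] else 0) \<in> lpa_relations G"
      unfolding lpa_relations_def using that by blast
    then show "word [Vertex v, Vertex v] - word [Vertex v] \<in> lpa_relations G" by simp
  qed
  show "word [Ghost f, Edge f] - word [Vertex (head G f)] \<in> lpa_ideal G" if "f \<in> arcs G"
  proof (rule relation)
    have "word [Ghost f, Edge f] - (if f = f then word [Vertex (head G f)] else 0) \<in> lpa_relations G"
      unfolding lpa_relations_def using that by blast
    then show "word [Ghost f, Edge f] - word [Vertex (head G f)] \<in> lpa_relations G" by simp
  qed
qed (rule subsetD[OF relations_in_ideal], unfold lpa_relations_def, blast)+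

lemma edge_ghost_factorizable:
  fixes m :: int
  assumes f: "f \<in> arcs G"
    and head: "(word [Vertex (head G f)] :: ('a, 'b, 'r::ring_1) lpa_free) \<in> factorizable m (- m)"
  shows "(word [Edge f, Ghost f] :: ('a, 'b, 'r) lpa_free) \<in> factorizable (m + 1) (- (m + 1))"
proof (rule factorizable_cong)
  (* The factor r(f) is inserted into f f* to make room for the factorization of r(f). *)
  have "(word [Edge f] * word [Vertex (head G f)] * word [Ghost f] :: ('a, 'b, 'r) lpa_free) \<in>
      factorizable (1 + m) (- m + - 1)"
    using f head by (intro factorizable_mult_left factorizable_mult_right gen_homogeneous)
  then show "(word [Edge f, Vertex (head G f), Ghost f] :: ('a, 'b, 'r) lpa_free) \<in>
      factorizable (m + 1) (- (m + 1))"
    by (simp add: word_mult add.commute)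
  have "((word [Edge f, Vertex (head G f)] - word [Edge f]) * word [Ghost f] :: ('a, 'b, 'r) lpa_free)
      \<in> lpa_ideal G"
    using f by (intro lpa_ideal_closed(4) relation_congruences(3) single_mem_free_ring) simp_all
  then show "(word [Edge f, Vertex (head G f), Ghost f] - word [Edge f, Ghost f] :: ('a, 'b, 'r) lpa_free)
      \<in> lpa_ideal G"
    by (simp add: left_diff_distrib word_mult)
qed

lemma ghost_edge_factorizable:
  fixes m :: int
  assumes f: "f \<in> arcs G"
    and tail: "(word [Vertex (tail G f)] :: ('a, 'b, 'r::ring_1) lpa_free) \<in> factorizable m (- m)"
  shows "(word [Ghost f, Edge f] :: ('a, 'b, 'r) lpa_free) \<in> factorizable (m - 1) (- (m - 1))"
proof (rule factorizable_cong)
  (* Likewise f* f is read as f* s(f) f. *)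
  have "(word [Ghost f] * word [Vertex (tail G f)] * word [Edge f] :: ('a, 'b, 'r) lpa_free) \<in>
      factorizable (- 1 + m) (- m + 1)"
    using f tail by (intro factorizable_mult_left factorizable_mult_right gen_homogeneous)
  then show "(word [Ghost f, Vertex (tail G f), Edge f] :: ('a, 'b, 'r) lpa_free) \<in>
      factorizable (m - 1) (- (m - 1))"
    by (simp add: word_mult)
  have "((word [Ghost f, Vertex (tail G f)] - word [Ghost f]) * word [Edge f] :: ('a, 'b, 'r) lpa_free)
      \<in> lpa_ideal G"
    using f by (intro lpa_ideal_closed(4) relation_congruences(5) single_mem_free_ring) simp_all
  then show "(word [Ghost f, Vertex (tail G f), Edge f] - word [Ghost f, Edge f] :: ('a, 'b, 'r) lpa_free)
      \<in> lpa_ideal G"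
    by (simp add: left_diff_distrib word_mult)
qed

text \<open>
  Upward induction on \<open>m\<close> uses that \<open>v\<close> is not a sink and emits finitely many edges, downward
  induction that it is not a source.
\<close>

lemma vertex_factorizable:
  fixes m :: int
  assumes row_finite: "row_finite G" and no_source: "\<nexists>v. is_source G v" and no_sink: "\<nexists>v. is_sink G v"
    and "v \<in> verts G"
  shows "(word [Vertex v] :: ('a, 'b, 'r::ring_1) lpa_free) \<in> factorizable m (- m)"
  using \<open>v \<in> verts G\<close>
proof (induction m arbitrary: v rule: int_induct[where k = 0])
  case base
  have "(word [Vertex v] * word [Vertex v] :: ('a, 'b, 'r) lpa_free) \<in> factorizable 0 0"
    by (intro factorizable_product gen_homogeneous base)
  then show ?case
    by (intro factorizable_cong[OF _ relation_congruences(1)[OF base]]) (simp add: word_mult)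
next
  case (step1 m)
  have out: "out_arcs G v \<noteq> {}" "finite (out_arcs G v)"
    using row_finite no_sink step1.prems by (auto simp: row_finite_def is_sink_def)
  have "(\<Sum>f\<in>out_arcs G v. word [Edge f, Ghost f] :: ('a, 'b, 'r) lpa_free) \<in>
      factorizable (m + 1) (- (m + 1))"
    by (intro factorizable_sum edge_ghost_factorizable step1.IH) auto
  then show ?case
    by (rule factorizable_cong) (rule relation_congruences(7)[OF step1.prems out])
next
  case (step2 m)
  have "in_arcs G v \<noteq> {}"
    using no_source step2.prems by (auto simp: is_source_def)
  then obtain f where f: "f \<in> arcs G" "head G f = v"
    by (auto simp: in_arcs_def)
  have "(word [Ghost f, Edge f] :: ('a, 'b, 'r) lpa_free) \<in> factorizable (m - 1) (- (m - 1))"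
    using f by (intro ghost_edge_factorizable step2.IH) auto
  then show ?case
    using relation_congruences(6)[OF f(1)] f(2) by (auto intro: factorizable_cong)
qed

text \<open>
  The vertex is the start of the first letter of the word.
\<close>

lemma left_unit:
  fixes c :: "'r::ring_1"
  assumes "set (letters w) \<subseteq> lpa_gens G" "letters w \<noteq> []"
  obtains v where "v \<in> verts G"
    and "word [Vertex v] * Poly_Mapping.single w c - Poly_Mapping.single w c \<in> lpa_ideal G"
proof -
  obtain g gs where w: "w = Word (g # gs)"
    using assms(2) by (cases w; cases "letters w") auto
  have single: "Poly_Mapping.single w c = word [g] * Poly_Mapping.single (Word gs) c"
    by (simp add: w mult_single plus_free_word_def)
  obtain v where v: "v \<in> verts G"
    "(word [Vertex v, g] - word [g] :: ('a, 'b, 'r) lpa_free) \<in> lpa_ideal G"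
  proof (cases g)
    case (Vertex v)
    with assms(1) that[of v] relation_congruences(1)[of v] show ?thesis by (simp add: w)
  next
    case (Edge f)
    with assms(1) that[of "tail G f"] relation_congruences(2)[of f] show ?thesis by (simp add: w)
  next
    case (Ghost f)
    with assms(1) that[of "head G f"] relation_congruences(4)[of f] show ?thesis by (simp add: w)
  qed
  have "(word [Vertex v, g] - word [g]) * Poly_Mapping.single (Word gs) c \<in> lpa_ideal G"
    using assms(1) v by (intro lpa_ideal_closed(4) single_mem_free_ring) (simp_all add: w)
  then show ?thesis
    using v(1) by (intro that[of v])
      (simp_all add: single left_diff_distrib mult.assoc[symmetric] word_mult)
qed

lemma homogeneous_factorizable:
  fixes p :: "('a, 'b, 'r::ring_1) lpa_free"
  assumes "row_finite G" "\<nexists>v. is_source G v" "\<nexists>v. is_sink G v"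
    and p: "p \<in> homogeneous (m + n)"
  shows "p \<in> factorizable m n"
proof (rule poly_mapping_additive_induct[where P = "\<lambda>p. p \<in> factorizable m n"])
  fix w and c :: 'r assume "w \<in> Poly_Mapping.keys p"
  with p have w: "set (letters w) \<subseteq> lpa_gens G" "w \<noteq> 0" "word_degree w = m + n"
    unfolding homogeneous_def nonconstant_def mem_free_ring by (auto simp: in_keys_iff)
  from w(2) have letters: "letters w \<noteq> []"
    by (cases w) (simp add: zero_free_word_def)
  obtain v where v: "v \<in> verts G"
    "word [Vertex v] * Poly_Mapping.single w c - Poly_Mapping.single w c \<in> lpa_ideal G"
    using left_unit[OF w(1) letters] by blast
  have "word [Vertex v] * Poly_Mapping.single w c \<in> factorizable m (- m + (m + n))"
    using vertex_factorizable[OF assms(1-3) v(1)] single_homogeneous[OF w(1) letters]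
    by (intro factorizable_mult_right) (simp_all add: w(3))
  then show "Poly_Mapping.single w c \<in> factorizable m n"
    using factorizable_cong v(2) by simp
qed (simp_all add: factorizable_zero factorizable_add)

lemma strongly_graded_if_no_sink:
  assumes "row_finite G" "\<nexists>v. is_source G v" "\<nexists>v. is_sink G v"
  shows "strongly_Z_graded_ring
    (leavitt_path_algebra G :: ('a, 'b, 'r::ring_1) lpa_free set ring) (lpa_component G)"
proof -
  interpret Z_graded_ring "leavitt_path_algebra G :: ('a, 'b, 'r) lpa_free set ring" "lpa_component G"
    by (rule Z_graded_ring_lpa)
  show ?thesis
  proof
    fix m n
    have "lpa_component G (m + n) \<subseteq> sums_of_products
        (leavitt_path_algebra G :: ('a, 'b, 'r) lpa_free set ring) (lpa_component G m) (lpa_component G n)"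
    proof
      fix x :: "('a, 'b, 'r) lpa_free set" assume "x \<in> lpa_component G (m + n)"
      then obtain p where "p \<in> homogeneous (m + n)" and x: "x = lpa_class G p"
        by (auto simp: lpa_component_eq)
      then have "p \<in> factorizable m n"
        by (intro homogeneous_factorizable assms)
      then obtain q where "q \<in> prod_sums (homogeneous m) (homogeneous n)" "p - q \<in> lpa_ideal G"
        unfolding factorizable_def by blast
      then show "x \<in> sums_of_products (leavitt_path_algebra G) (lpa_component G m) (lpa_component G n)"
        by (simp add: sums_of_products_components x lpa_class_eq_iff[symmetric])
    qed
    with component_mult show "sums_of_products (leavitt_path_algebra G :: ('a, 'b, 'r) lpa_free set ring)
        (lpa_component G m) (lpa_component G n) = lpa_component G (m + n)"
      by (intro equalityI)
  qed
qed

section \<open>Paths ending in a sink\<close>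

text \<open>
  All three clauses test that the path really ends in \<open>v\<close>. Without this the relations would fail on
  lists of edges that are not paths.
\<close>

primrec path_act :: "'a \<Rightarrow> ('a, 'b) lpa_gen \<Rightarrow> 'b awalk \<Rightarrow> 'b awalk option" where
  "path_act v (Vertex u) p = (if awalk u p v then Some p else None)"
| "path_act v (Edge f) p = (if f \<in> arcs G \<and> awalk (head G f) p v then Some (f # p) else None)"
| "path_act v (Ghost f) p = (if p \<noteq> [] \<and> hd p = f \<and> awalk (tail G f) p v then Some (tl p) else None)"

lemma length_path_act:
  "word_act (path_act v) gs p = Some q \<Longrightarrow> int (length q) = int (length p) + word_degree (Word gs)"
proof (induction gs arbitrary: q)
  case (Cons g gs)
  then obtain r where "word_act (path_act v) gs p = Some r" "path_act v g r = Some q"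
    by (auto simp: bind_eq_Some_conv)
  with Cons.IH[of r] show ?case by (cases g; cases r) (auto split: if_splits)
qed simp

text \<open>
  The empty path starts at its end \<open>v\<close>, so distinct vertices keep disjoint sets of paths.
\<close>

lemma awalk_start_unique: "awalk u p v \<Longrightarrow> awalk w p v \<Longrightarrow> u = w"
  by (cases p) (auto simp: awalk_simps)

lemma awalk_tl: "awalk u p v \<Longrightarrow> p \<noteq> [] \<Longrightarrow> awalk (head G (hd p)) (tl p) v"
  by (cases p) (auto simp: awalk_simps)

text \<open>
  Only the relation \<open>\<Sum> f f\<^sup>* = u\<close> needs thought. A nonempty path starting in \<open>u\<close> is kept by
  exactly one \<open>f f\<^sup>*\<close>, that of its first edge. The empty path is kept by none, and \<open>u\<close> does not keep it either, because \<open>u\<close> emits an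
  edge and hence is not \<open>v\<close>.
\<close>

lemma right_act_path_act_relation:
  fixes r :: "('a, 'b, 'r::ring_1) lpa_free"
  assumes "out_arcs G v = {}" and "r \<in> lpa_relations G"
  shows "right_act (path_act v) h r p = 0"
proof -
  have sum: "right_act (path_act v) h (\<Sum>f\<in>out_arcs G u. word [Edge f, Ghost f]) p =
      right_act (path_act v) h (word [Vertex u]) p"
    if u: "out_arcs G u \<noteq> {}" "finite (out_arcs G u)" for u
  proof (cases p)
    case Nil
    with u assms(1) show ?thesis by (auto simp: right_act_sum awalk_simps)
  next
    case (Cons g q)
    have "right_act (path_act v) h (\<Sum>f\<in>out_arcs G u. word [Edge f, Ghost f]) p =
        (\<Sum>f\<in>out_arcs G u. if f = g then (if awalk u p v then h p else 0) else 0)"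
      unfolding right_act_sum using Cons by (intro sum.cong) (auto simp: awalk_simps)
    also have "\<dots> = (if awalk u p v then h p else 0)"
      using u(2) Cons by (auto simp: sum.delta awalk_simps)
    finally show ?thesis by simp
  qed
  have "r \<in> lpa_relations G \<longrightarrow> right_act (path_act v) h r p = 0"
    unfolding lpa_relations_def
    by (intro impI; elim UnE CollectE exE conjE; hypsubst)
      (auto simp: sum awalk_simps dest: awalk_start_unique awalk_tl split: option.split)
  then show ?thesis using assms(2) by blast
qed

lemma right_act_path_act_ideal:
  fixes p :: "('a, 'b, 'r::ring_1) lpa_free"
  assumes "out_arcs G v = {}" and "p \<in> lpa_ideal G"
  shows "right_act (path_act v) h p x = 0"
proof -
  have "lpa_ideal G \<subseteq> {p :: ('a, 'b, 'r) lpa_free.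
      p \<in> carrier (free_ring (lpa_gens G)) \<and> (\<forall>h x. right_act (path_act v) h p x = 0)}"
    using relations_subset right_act_path_act_relation[OF assms(1)]
    by (intro lpa_ideal_minimal ideal_annihilator) blast
  with assms(2) show ?thesis by blast
qed

text \<open>
  A word of positive degree lengthens paths, so it never reaches the empty path, on which alone the
  function is nonzero.
\<close>

lemma right_act_positive_degree:
  fixes p :: "('a, 'b, 'r::ring_1) lpa_free"
  assumes "p \<in> homogeneous n" "n > 0"
  shows "right_act (path_act v) (\<lambda>q. if q = [] then 1 else 0) p x = 0"
  unfolding right_act_def
proof (rule sum.neutral, intro ballI)
  fix w assume "w \<in> Poly_Mapping.keys p"
  with assms have "word_degree w > 0" by (auto simp: homogeneous_def)
  then show "case_option 0 (\<lambda>q. if q = [] then 1 else 0) (word_act (path_act v) (letters w) x) *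
      Poly_Mapping.lookup p w = 0"
    using length_path_act[of v "letters w" x "[]"]
    by (auto split: option.split)
qed

lemma no_sink_if_strongly_graded:
  assumes "strongly_Z_graded_ring
    (leavitt_path_algebra G :: ('a, 'b, 'r::ring_1) lpa_free set ring) (lpa_component G)"
  shows "\<not> is_sink G v"
proof
  assume "is_sink G v"
  then have v: "v \<in> verts G" "out_arcs G v = {}" by (simp_all add: is_sink_def)
  interpret strongly_Z_graded_ring
    "leavitt_path_algebra G :: ('a, 'b, 'r) lpa_free set ring" "lpa_component G"
    by (rule assms)
  (* The functional that reads off the coefficient of the empty path. *)
  define h :: "'b awalk \<Rightarrow> 'r" where "h = (\<lambda>q. if q = [] then 1 else 0)"
  have "lpa_class G (word [Vertex v] :: ('a, 'b, 'r) lpa_free) \<in> lpa_component G (1 + - 1)"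
    using gen_homogeneous(1)[OF v(1)] by (auto simp: lpa_component_eq)
  then obtain q :: "('a, 'b, 'r) lpa_free" where "q \<in> prod_sums (homogeneous 1) (homogeneous (- 1))"
    and q: "word [Vertex v] - q \<in> lpa_ideal G"
    unfolding component_mult_eq[of 1 "- 1", symmetric] sums_of_products_components
    by (auto simp: lpa_class_eq_iff)
  then obtain k :: nat and a b where "q = (\<Sum>i<k. a i * b i)"
    and a: "\<And>i. i < k \<Longrightarrow> a i \<in> homogeneous 1"
    unfolding prod_sums_def by blast
  moreover have "right_act (path_act v) h (a i) = (\<lambda>_. 0)" if "i < k" for i
    using right_act_positive_degree[OF a[OF that]] by (auto simp: h_def)
  ultimately have "right_act (path_act v) h q [] = 0"
    by (simp add: right_act_sum right_act_mult)
  moreover have "right_act (path_act v) h (word [Vertex v]) [] = 1"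
    using v by (simp add: awalk_simps h_def)
  ultimately show False
    using right_act_path_act_ideal[OF v(2) q, of h "[]"] by simp
qed

end

theorem theorem47:
  fixes E :: "('v, 'e) pre_digraph"
  assumes "wf_digraph E"
    and "row_finite E"
    and "\<nexists>v. is_source E v"
  shows "strongly_Z_graded_ring
           (leavitt_path_algebra E :: ('v, 'e, 'r::ring_1) lpa_free set ring) (lpa_component E)
         \<longleftrightarrow> (\<nexists>v. is_sink E v)"
  using wf_digraph.strongly_graded_if_no_sink[OF assms]
    wf_digraph.no_sink_if_strongly_graded[OF assms(1)] by blast

end
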